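(* Let $n \geq 8$ and let $G = CS_{7,n-7}$ be the cycle-star graph with cycle length $k=7$ and $n-k \geq 1$ pendant vertices. Then $es(G) = n-3$ if $n = 8$; $es(G) = n-4$ if $n \in \{9,10\}$; and $es(G) = n-5$ if $n \geq 11$.
   Context: For integers $k \geq 3$ and $n > k$, the cycle-star graph $CS_{k,n-k}$ is the simple graph on $n$ vertices consisting of a cycle of length $k$ together with $n-k$ additional vertices of degree one (leaves), all adjacent to the same single vertex of the cycle. For a simple graph $G$, a vertex $k$-labeling is a map $\phi: V(G) \to \{1,2,\ldots,k\}$; the weight of an edge $uv$ is $w_\phi(uv) = \phi(u)+\phi(v)$. The labeling is an edge irregular $k$-labeling if distinct edges have distinct weights. The edge irregularity strength $es(G)$ is the minimum $k$ for which $G$ admits an edge irregular $k$-labeling. *)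

theory Defs
  imports Main
begin

text \<open>A simple graph is a pair of a vertex set and a set of edges, each edge being
  the two-element set of its endpoints.\<close>

type_synonym 'a graph = "'a set \<times> 'a set set"

definition simple_graph :: "'a graph \<Rightarrow> bool" where
  "simple_graph G \<longleftrightarrow> (\<forall>e \<in> snd G. e \<subseteq> fst G \<and> card e = 2)"

definition vertex_labeling :: "'a graph \<Rightarrow> nat \<Rightarrow> ('a \<Rightarrow> nat) \<Rightarrow> bool" where
  "vertex_labeling G k \<phi> \<longleftrightarrow> (\<forall>v \<in> fst G. \<phi> v \<in> {1..k})"

definition edge_weight :: "('a \<Rightarrow> nat) \<Rightarrow> 'a set \<Rightarrow> nat" where
  "edge_weight \<phi> e = (\<Sum>v\<in>e. \<phi> v)"

lemma edge_weight_edge: "u \<noteq> v \<Longrightarrow> edge_weight \<phi> {u, v} = \<phi> u + \<phi> v"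
  by (simp add: edge_weight_def)

definition edge_irregular_labeling :: "'a graph \<Rightarrow> nat \<Rightarrow> ('a \<Rightarrow> nat) \<Rightarrow> bool" where
  "edge_irregular_labeling G k \<phi> \<longleftrightarrow>
     vertex_labeling G k \<phi> \<and> inj_on (edge_weight \<phi>) (snd G)"

text \<open>For finite simple graphs an edge irregular labeling always exists (label the
  vertices by distinct powers of 2), so the minimum below is attained.\<close>

definition es :: "'a graph \<Rightarrow> nat" where
  "es G = (LEAST k. \<exists>\<phi>. edge_irregular_labeling G k \<phi>)"

text \<open>The graph with a cycle of length \<open>k\<close> on the vertices \<open>0, \<dots>, k - 1\<close> and \<open>m\<close> leaves
  \<open>k, \<dots>, k + m - 1\<close>, all attached to the cycle vertex \<open>0\<close>; it is meant for \<open>k \<ge> 3\<close>.\<close>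

definition cycle_star :: "nat \<Rightarrow> nat \<Rightarrow> nat graph" where
  "cycle_star k m =
     ({..<k + m},
      {{i, (i + 1) mod k} | i. i < k} \<union> {{0, j} | j. k \<le> j \<and> j < k + m})"

lemma simple_graph_cycle_star:
  assumes "k \<ge> 3"
  shows "simple_graph (cycle_star k m)"
  unfolding simple_graph_def
proof
  fix e assume "e \<in> snd (cycle_star k m)"
  then consider (cycle) i where "i < k" "e = {i, (i + 1) mod k}"
    | (leaf) j where "k \<le> j" "j < k + m" "e = {0, j}"
    unfolding cycle_star_def snd_conv by blast
  then show "e \<subseteq> fst (cycle_star k m) \<and> card e = 2"
  proof cases
    case cycle
    have "i \<noteq> (i + 1) mod k \<and> (i + 1) mod k < k + m"
    proof (cases "i + 1 = k")
      case True
      then show ?thesis using assms by simp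
    next
      case False
      then have "i + 1 < k" using cycle by linarith
      then show ?thesis by simp
    qed
    then show ?thesis using cycle by (simp add: cycle_star_def trans_less_add1)
  next
    case leaf
    then show ?thesis using assms by (simp add: cycle_star_def)
  qed
qed

lemma card_vertices_cycle_star: "card (fst (cycle_star k m)) = k + m"
  by (simp add: cycle_star_def)

end

theory Submission
  imports Defs
begin

text \<open>Lower bounds: the edges at the centre force its \<open>n - 5\<close> neighbours to carry distinct labels,
  so \<open>es \<ge> n - 5\<close>; all \<open>n\<close> edge weights lie in \<open>{2..2 * es}\<close>, so \<open>2 * es \<ge> n + 1\<close>. The second bound
  is the stronger one exactly for \<open>n \<le> 10\<close>.

  Upper bounds: around the cycle, starting at the centre, the labels \<open>6, 5, 1, 1, 2, 2, 3\<close> put the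
  edges away from the centre on the weights \<open>2, \<dots>, 6\<close>, leaving \<open>7, 8, \<dots>\<close> for the edges at the
  centre; the leaves take the labels other than \<open>3\<close> and \<open>5\<close> in increasing order. For \<open>n \<le> 9\<close> the
  cycle labels \<open>3, 5, 5, 4, 2, 1, 1\<close> and leaf labels \<open>2, 4\<close> use only labels up to \<open>5\<close>.\<close>

text \<open>There are as many edges as vertices, so each edge is indexed by a vertex: a cycle vertex
  by the cycle edge leaving it, a leaf by its pendant edge. Distinct weights then become injectivity
  of a function on \<open>{..<k + m}\<close>.\<close>

definition cycle_star_edge :: "nat \<Rightarrow> nat \<Rightarrow> nat set" where
  "cycle_star_edge k i = (if i < k then {i, (i + 1) mod k} else {0, i})"

lemma snd_cycle_star: "snd (cycle_star k m) = cycle_star_edge k ` {..<k + m}"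
proof -
  have "{{i, (i + 1) mod k} | i. i < k} = cycle_star_edge k ` {..<k}"
    "{{0, j} | j. k \<le> j \<and> j < k + m} = cycle_star_edge k ` {k..<k + m}"
    unfolding Setcompr_eq_image by (force simp: cycle_star_edge_def intro: image_cong)+
  moreover have "{..<k + m} = {..<k} \<union> {k..<k + m}" by auto
  ultimately show ?thesis by (simp only: cycle_star_def snd_conv image_Un)
qed

text \<open>For \<open>k = 2\<close> the edges with indices 0 and 1 would coincide.\<close>

lemma inj_on_cycle_star_edge:
  assumes "k \<ge> 3"
  shows "inj_on (cycle_star_edge k) {..<k + m}"
proof (rule inj_onI)
  fix i j assume "cycle_star_edge k i = cycle_star_edge k j"
  then show "i = j"
    using assms
    \<comment> \<open>The splits on \<open>Suc i = k\<close> and \<open>Suc j = k\<close> single out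
      the edge that closes the cycle, where \<open>mod\<close> wraps to 0.\<close>
    by (cases "i < k"; cases "j < k"; cases "Suc i = k"; cases "Suc j = k")
      (simp_all add: cycle_star_edge_def doubleton_eq_iff mod_Suc, linarith)
qed

lemma edge_weight_cycle_star_edge:
  assumes "k \<ge> 3"
  shows "edge_weight \<phi> (cycle_star_edge k i) =
    (if i < k then \<phi> i + \<phi> ((i + 1) mod k) else \<phi> 0 + \<phi> i)"
  using assms by (auto simp: cycle_star_edge_def mod_Suc edge_weight_edge)

lemma edge_irregular_labeling_card_le:
  assumes "edge_irregular_labeling G s \<phi>" "simple_graph G"
  shows "card (snd G) \<le> 2 * s - 1"
proof -
  have "edge_weight \<phi> e \<in> {2..2 * s}" if "e \<in> snd G" for e
  proof -
    from that assms(2) have "e \<subseteq> fst G" "card e = 2"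
      by (simp_all add: simple_graph_def)
    then obtain u v where e: "e = {u, v}" "u \<noteq> v" "u \<in> fst G" "v \<in> fst G"
      by (auto simp: card_2_iff)
    then have "\<phi> u \<in> {1..s}" "\<phi> v \<in> {1..s}"
      using assms(1) unfolding edge_irregular_labeling_def vertex_labeling_def by blast+
    then show ?thesis using e by (simp add: edge_weight_edge)
  qed
  \<comment> \<open>For \<open>s = 0\<close> the interval is empty, in agreement with the truncated
    \<open>2 * s - 1\<close>.\<close>
  then have "card (snd G) \<le> card {2..2 * s}"
    using assms(1) unfolding edge_irregular_labeling_def
    by (intro card_inj_on_le[of "edge_weight \<phi>"]) auto
  then show ?thesis by simp
qed

text \<open>Edges at \<open>c\<close> share the summand \<open>\<phi> c\<close>, so their weights
  differ only if the labels at their other ends do.\<close>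

lemma edge_irregular_labeling_degree_le:
  assumes lab: "edge_irregular_labeling G s \<phi>"
    and N: "N \<subseteq> fst G" "c \<notin> N" "\<And>v. v \<in> N \<Longrightarrow> {c, v} \<in> snd G"
  shows "card N \<le> s"
proof -
  have "inj_on \<phi> N"
  proof (rule inj_onI)
    fix u v assume uv: "u \<in> N" "v \<in> N" "\<phi> u = \<phi> v"
    then have "c \<noteq> u" "c \<noteq> v" using N(2) by auto
    then have "edge_weight \<phi> {c, u} = edge_weight \<phi> {c, v}"
      using uv by (simp add: edge_weight_edge)
    then have "{c, u} = {c, v}"
      using lab N(3) uv unfolding edge_irregular_labeling_def by (blast dest: inj_onD)
    then show "u = v" by (auto simp: doubleton_eq_iff)
  qed
  moreover have "\<phi> ` N \<subseteq> {1..s}"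
    using lab N(1) unfolding edge_irregular_labeling_def vertex_labeling_def by blast
  ultimately have "card N \<le> card {1..s}" by (intro card_inj_on_le) auto
  then show ?thesis by simp
qed

lemma cycle_star_labeling_lower_bounds:
  assumes "k \<ge> 3" "edge_irregular_labeling (cycle_star k m) s \<phi>"
  shows "k + m \<le> 2 * s - 1" and "m + 2 \<le> s"
proof -
  have "card (snd (cycle_star k m)) = k + m"
    unfolding snd_cycle_star using inj_on_cycle_star_edge[OF assms(1)] by (simp add: card_image)
  then show "k + m \<le> 2 * s - 1"
    using edge_irregular_labeling_card_le[OF assms(2) simple_graph_cycle_star[OF assms(1)]] by simp
  \<comment> \<open>The neighbours of the centre 0: the cycle vertices 1 and \<open>k - 1\<close>,
    distinct since \<open>k \<ge> 3\<close>, and the leaves, which are numbered on from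
    \<open>k - 1\<close>.\<close>
  let ?N = "insert 1 {k - 1..<k + m}"
  have "{0, v} \<in> snd (cycle_star k m)" if "v \<in> ?N" for v
  proof -
    from that have "v = 1 \<or> v = k - 1 \<or> (v \<ge> k \<and> v < k + m)" by auto
    then consider "v = 1" | "v = k - 1" | "v \<ge> k" "v < k + m" by blast
    then show ?thesis
    proof cases
      case 1
      then have "{0, v} = cycle_star_edge k 0" using assms(1) by (simp add: cycle_star_edge_def)
      then show ?thesis using assms(1) by (simp add: snd_cycle_star)
    next
      case 2
      then have "{0, v} = cycle_star_edge k (k - 1)"
        using assms(1) by (simp add: cycle_star_edge_def insert_commute)
      then show ?thesis using assms(1) by (simp add: snd_cycle_star)
    next
      case 3
      then have "{0, v} = cycle_star_edge k v" by (simp add: cycle_star_edge_def)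
      then show ?thesis using 3 by (simp add: snd_cycle_star)
    qed
  qed
  moreover have "?N \<subseteq> fst (cycle_star k m)" "0 \<notin> ?N"
    using assms(1) by (auto simp: cycle_star_def)
  ultimately have "card ?N \<le> s"
    by (intro edge_irregular_labeling_degree_le[OF assms(2)])
  moreover have "card ?N = m + 2" using assms(1) by simp
  ultimately show "m + 2 \<le> s" by simp
qed

lemma edge_irregular_labeling_cycle_starI:
  assumes "k \<ge> 3" "\<And>i. i < k + m \<Longrightarrow> 1 \<le> \<phi> i \<and> \<phi> i \<le> s"
    and "inj_on (\<lambda>i. if i < k then \<phi> i + \<phi> ((i + 1) mod k) else \<phi> 0 + \<phi> i) {..<k + m}"
  shows "edge_irregular_labeling (cycle_star k m) s \<phi>"
proof -
  have "inj_on (edge_weight \<phi> \<circ> cycle_star_edge k) {..<k + m}"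
    using assms(3) by (simp add: edge_weight_cycle_star_edge[OF assms(1)] comp_def)
  then have "inj_on (edge_weight \<phi>) (snd (cycle_star k m))"
    unfolding snd_cycle_star by (rule inj_on_imageI)
  then show ?thesis
    using assms(2) by (simp add: edge_irregular_labeling_def vertex_labeling_def cycle_star_def)
qed

lemma cycle_star_7_labeling_small:
  assumes "m \<le> 2"
  shows "\<exists>\<phi>. edge_irregular_labeling (cycle_star 7 m) 5 \<phi>"
proof -
  define \<phi> :: "nat \<Rightarrow> nat" where "\<phi> = (\<lambda>i. [3, 5, 5, 4, 2, 1, 1, 2, 4] ! i)"
  \<comment> \<open>The weights in index order. They exhaust 2 to 10, all that labels up to 5 can
    produce, so the counting bound is attained at \<open>m = 2\<close>.\<close>
  define w :: "nat \<Rightarrow> nat" where "w = (\<lambda>i. [8, 10, 9, 6, 3, 2, 4, 5, 7] ! i)"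
  have less_9: "i \<in> {0, 1, 2, 3, 4, 5, 6, 7, 8}" if "i < 7 + m" for i
    using that assms by auto
  have w: "(if i < 7 then \<phi> i + \<phi> ((i + 1) mod 7) else \<phi> 0 + \<phi> i) = w i" if "i < 7 + m" for i
    using less_9[OF that] by (auto simp: \<phi>_def w_def)
  have "inj_on w {..<9}"
    unfolding w_def by (rule inj_on_nth) auto
  then have "inj_on w {..<7 + m}"
    by (rule inj_on_subset) (use assms in auto)
  then have "inj_on (\<lambda>i. if i < 7 then \<phi> i + \<phi> ((i + 1) mod 7) else \<phi> 0 + \<phi> i) {..<7 + m}"
    using w by (subst inj_on_cong[where g = w]) auto
  moreover have "1 \<le> \<phi> i \<and> \<phi> i \<le> 5" if "i < 7 + m" for i
    using less_9[OF that] by (auto simp: \<phi>_def)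
  ultimately show ?thesis
    using edge_irregular_labeling_cycle_starI[of 7 m \<phi> 5] by auto
qed

lemma cycle_star_7_labeling_large:
  "\<exists>\<phi>. edge_irregular_labeling (cycle_star 7 m) (max 6 (m + 2)) \<phi>"
proof -
  define \<phi> :: "nat \<Rightarrow> nat" where
    \<comment> \<open>Leaves 7, 8, 9 take 1, 2, 4; from leaf 10 on the labels are 6, 7, and so on,
      so for \<open>m \<ge> 4\<close> the last leaf \<open>m + 6\<close> gets \<open>m + 2\<close>.
      The 6 in the maximum is the label of the centre.\<close>
    "\<phi> = (\<lambda>i. if i < 10 then [6, 5, 1, 1, 2, 2, 3, 1, 2, 4] ! i else i - 4)"
  define w :: "nat \<Rightarrow> nat" where
    \<comment> \<open>The first ten weights permute 2 to 11; the remaining ones increase from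
      12.\<close>
    "w = (\<lambda>i. if i < 10 then [11, 6, 2, 3, 4, 5, 9, 7, 8, 10] ! i else i + 2)"
  have cases_10: "i \<in> {0, 1, 2, 3, 4, 5, 6, 7, 8, 9} \<or> i \<ge> 10" for i :: nat
    by auto
  have w: "(if i < 7 then \<phi> i + \<phi> ((i + 1) mod 7) else \<phi> 0 + \<phi> i) = w i" for i
    using cases_10[of i] by (auto simp: \<phi>_def w_def)
  have small: "w i < 12" if "i < 10" for i
    using cases_10[of i] that by (auto simp: w_def)
  have "inj_on ((!) [11, 6, 2, 3, 4, 5, 9, 7, 8, 10 :: nat]) {..<10}"
    by (rule inj_on_nth) auto
  then have "inj_on w {..<10}"
    by (simp add: w_def inj_on_def)
  moreover have "inj_on w {10..}"
    by (auto simp: w_def inj_on_def)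
  moreover have "w i \<noteq> w j" if "i < 10" "j \<ge> 10" for i j
    using small[OF that(1)] that(2) by (simp add: w_def)
  ultimately have "inj_on w ({..<10} \<union> {10..})"
    unfolding inj_on_Un by (auto simp: image_iff)
  then have "inj_on w {..<7 + m}"
    by (rule inj_on_subset) auto
  then have "inj_on (\<lambda>i. if i < 7 then \<phi> i + \<phi> ((i + 1) mod 7) else \<phi> 0 + \<phi> i) {..<7 + m}"
    by (simp add: w)
  moreover have "1 \<le> \<phi> i \<and> \<phi> i \<le> max 6 (m + 2)" if "i < 7 + m" for i
    using cases_10[of i] that by (auto simp: \<phi>_def)
  ultimately show ?thesis
    using edge_irregular_labeling_cycle_starI[of 7 m \<phi> "max 6 (m + 2)"] by auto
qed

lemma es_eqI:
  assumes "\<exists>\<phi>. edge_irregular_labeling G k \<phi>"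
    and "\<And>s \<phi>. edge_irregular_labeling G s \<phi> \<Longrightarrow> k \<le> s"
  shows "es G = k"
  unfolding es_def using assms by (intro Least_equality) auto

theorem theorem3p6:
  fixes n :: nat
  assumes "n \<ge> 8"
  shows "es (cycle_star 7 (n - 7)) =
    (if n = 8 then n - 3 else if n \<in> {9, 10} then n - 4 else n - 5)"
    (is "_ = ?s")
proof (rule es_eqI)
  show "\<exists>\<phi>. edge_irregular_labeling (cycle_star 7 (n - 7)) ?s \<phi>"
  \<comment> \<open>The claimed value is 5 for both 8 and 9; for 10 it is 6, and from 11 on it is
    \<open>n - 5\<close>, which is at least 6.\<close>
  proof (cases "n \<le> 9")
    case True
    then have "?s = 5" using assms by auto
    then show ?thesis using cycle_star_7_labeling_small[of "n - 7"] True by simp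
  next
    case False
    then have "?s = max 6 (n - 7 + 2)" by auto
    then show ?thesis using cycle_star_7_labeling_large[of "n - 7"] by simp
  qed
next
  fix s \<phi> assume "edge_irregular_labeling (cycle_star 7 (n - 7)) s \<phi>"
  \<comment> \<open>Counting weights gives \<open>2 * s \<ge> n + 1\<close>, which rounds up to 5,
    5, 6 for \<open>n\<close> = 8, 9, 10; the degree of the centre gives \<open>n - 5\<close>
    beyond.\<close>
  from cycle_star_labeling_lower_bounds[OF _ this]
  show "?s \<le> s" using assms by auto
qed

end
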